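(* For positive integers $k$ and $g$, the $k$-power domination number of the Sierpiński graph $\mathcal{S}_g$ is $$\gamma_{P,k}(\mathcal{S}_g)=\begin{cases}\dfrac{3^{g-2}+1}{2}, & g\ge 2,\ k=1,\\[2mm] 1, & g=1,\ k=1,\\[1mm] 1, & k\ge 2.\end{cases}$$
   Context: Sierpiński graph: $\mathcal{S}_1$ is a triangle whose three vertices are its outmost vertices. Given $\mathcal{S}_g$ with outmost vertices $A_g,B_g,C_g$, take three copies $\mathcal{S}_g^\theta$ ($\theta=1,2,3$) with outmost vertices $A_g^\theta,B_g^\theta,C_g^\theta$, identify $B_g^1$ with $A_g^2$, $C_g^2$ with $B_g^3$, and $C_g^1$ with $A_g^3$; the result is $\mathcal{S}_{g+1}$, with outmost vertices $A_g^1$, $B_g^2$, $C_g^3$. For a graph $G$, nonnegative integer $k$ and $D\subseteq V(G)$: $P^0_{G,k}(D)=N_G[D]$ (closed neighborhood), $P^{i+1}_{G,k}(D)=\bigcup\{N_G[v]: v\in P^i_{G,k}(D),\ |N_G[v]\setminus P^i_{G,k}(D)|\le k\}$; the increasing sequence stabilizes at $P^\infty_{G,k}(D)$. $D$ is a $k$-power dominating set if $P^\infty_{G,k}(D)=V(G)$; $\gamma_{P,k}(G)$ is the minimum size of such a set. *)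

theory Defs
  imports Complex_Main "Graph_Theory.Pair_Digraph"
begin

text \<open>
  Undirected simple graphs are the symmetric loop-free finite digraphs of \<open>pair_graph\<close>: an edge
  \<open>uv\<close> is the pair of arcs \<open>(u, v)\<close>, \<open>(v, u)\<close>.
\<close>

section \<open>Sierpinski graphs\<close>

text \<open>
  A vertex of the \<open>g\<close>-th graph is a word of length \<open>g\<close> over \<open>{1, 2, 3}\<close>; \<open>t # v\<close> is the vertex
  \<open>v\<close> of copy number \<open>t\<close>. The outmost vertices of the \<open>g\<close>-th graph are \<open>outmost 1 g\<close>,
  \<open>outmost 2 g\<close>, \<open>outmost 3 g\<close> (in this order: \<open>A\<close>, \<open>B\<close>, \<open>C\<close>), since outmost vertex number
  \<open>t\<close> of the next graph is outmost vertex number \<open>t\<close> of copy \<open>t\<close>.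
\<close>

fun outmost :: "nat \<Rightarrow> nat \<Rightarrow> nat list" where
  "outmost t 0 = []"
| "outmost t (Suc g) = t # outmost t g"

text \<open>
  The quotient map that merges, in the disjoint union of three copies of a graph with outmost
  vertices \<open>a\<close>, \<open>b\<close>, \<open>c\<close>, the pairs \<open>b\<close> of copy 1 and \<open>a\<close> of copy 2, \<open>c\<close> of copy 2 and \<open>b\<close> of
  copy 3, \<open>c\<close> of copy 1 and \<open>a\<close> of copy 3. Each class is represented by its member in the copy of
  smaller number.
\<close>

definition identify :: "nat list \<Rightarrow> nat list \<Rightarrow> nat list \<Rightarrow> nat list \<Rightarrow> nat list" where
  "identify a b c x =
    (if x = 2 # a then 1 # b
     else if x = 3 # b then 2 # c
     else if x = 3 # a then 1 # c
     else x)"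

definition glue_copies ::
    "nat list \<Rightarrow> nat list \<Rightarrow> nat list \<Rightarrow> nat list pair_pre_digraph \<Rightarrow> nat list pair_pre_digraph" where
  "glue_copies a b c G =
    \<lparr> pverts = {identify a b c (t # v) | t v. t \<in> {1, 2, 3} \<and> v \<in> pverts G},
      parcs = {(identify a b c (t # u), identify a b c (t # v)) | t u v.
                t \<in> {1, 2, 3} \<and> (u, v) \<in> parcs G} \<rparr>"

text \<open>The index starts at 1; the value at 0 is a dummy.\<close>

fun sierpinski :: "nat \<Rightarrow> nat list pair_pre_digraph" where
  "sierpinski 0 = \<lparr> pverts = {}, parcs = {} \<rparr>"
| "sierpinski (Suc 0) =
    \<lparr> pverts = {[1], [2], [3]},
      parcs = {(u, v). u \<in> {[1], [2], [3]} \<and> v \<in> {[1], [2], [3]} \<and> u \<noteq> v} \<rparr>"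
| "sierpinski (Suc (Suc g)) =
    glue_copies (outmost 1 (Suc g)) (outmost 2 (Suc g)) (outmost 3 (Suc g)) (sierpinski (Suc g))"

lemma identify_eq_iff:
  assumes "distinct [a, b, c]"
  shows "identify a b c x = identify a b c y \<longleftrightarrow>
    x = y \<or> {x, y} = {1 # b, 2 # a} \<or> {x, y} = {2 # c, 3 # b} \<or> {x, y} = {1 # c, 3 # a}"
proof -
  have aux: "(if x = q1 then p1 else if x = q2 then p2 else if x = q3 then p3 else x) =
      (if y = q1 then p1 else if y = q2 then p2 else if y = q3 then p3 else y) \<longleftrightarrow>
      x = y \<or> {x, y} = {p1, q1} \<or> {x, y} = {p2, q2} \<or> {x, y} = {p3, q3}"
    if "distinct [p1, p2, p3, q1, q2, q3]" for p1 p2 p3 q1 q2 q3 :: "nat list"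
    using that unfolding doubleton_eq_iff by (simp split del: if_split) (smt (verit))
  show ?thesis
    unfolding identify_def by (rule aux) (use assms in auto)
qed

lemma distinct_outmost: "distinct [outmost 1 (Suc g), outmost 2 (Suc g), outmost 3 (Suc g)]"
  by simp

lemma pair_graph_glue_copies:
  assumes "pair_graph G" "distinct [a, b, c]"
  shows "pair_graph (glue_copies a b c G)"
proof -
  interpret G: pair_graph G by fact
  let ?H = "glue_copies a b c G" and ?q = "identify a b c"
  have V: "pverts ?H = (\<Union>t\<in>{1, 2, 3}. (\<lambda>v. ?q (t # v)) ` pverts G)"
    unfolding glue_copies_def by auto
  have E: "parcs ?H = (\<Union>t\<in>{1, 2, 3}. (\<lambda>(u, v). (?q (t # u), ?q (t # v))) ` parcs G)"
    unfolding glue_copies_def by auto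
  show ?thesis
  proof
    show "finite (pverts ?H)" "finite (parcs ?H)"
      unfolding V E by auto
    show "fst e \<in> pverts ?H" "snd e \<in> pverts ?H" if "e \<in> parcs ?H" for e
      using that unfolding V E by (auto dest: G.in_arcsD1 G.in_arcsD2)
    show "fst e \<noteq> snd e" if "e \<in> parcs ?H" for e
    proof -
      from that obtain t u v where e: "e = (?q (t # u), ?q (t # v))" and uv: "(u, v) \<in> parcs G"
        by (auto simp: glue_copies_def)
      have "u \<noteq> v" using G.pair_no_loops[OF uv] by simp
      then show ?thesis
        using assms(2) by (auto simp: e identify_eq_iff doubleton_eq_iff)
    qed
    have "sym (parcs ?H)"
    proof (rule symI)
      fix x y assume "(x, y) \<in> parcs ?H"
      then obtain t u v where *: "x = ?q (t # u)" "y = ?q (t # v)" "t \<in> {1, 2, 3}" "(u, v) \<in> parcs G"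
        by (auto simp: glue_copies_def)
      then have "(v, u) \<in> parcs G" by (simp add: G.arcs_symmetric)
      with *(3) have "(?q (t # v), ?q (t # u)) \<in> parcs ?H"
        unfolding glue_copies_def by simp blast
      with *(1,2) show "(y, x) \<in> parcs ?H" by simp
    qed
    then show "symmetric ?H"
      by (simp add: symmetric_def)
  qed
qed

lemma pair_graph_sierpinski: "pair_graph (sierpinski g)"
proof (induction g rule: sierpinski.induct)
  case 1
  show ?case by unfold_locales (auto simp: symmetric_def sym_def)
next
  case 2
  have "finite (parcs (sierpinski (Suc 0)))"
    by (rule finite_subset[of _ "{[1], [2], [3]} \<times> {[1], [2], [3]}"]) auto
  then show ?case by unfold_locales (auto simp: symmetric_def sym_def)
next
  case (3 g)
  then show ?case
    using pair_graph_glue_copies[OF _ distinct_outmost] by simp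
qed

section \<open>Generalized power domination\<close>

definition closed_nbhd :: "'a pair_pre_digraph \<Rightarrow> 'a \<Rightarrow> 'a set" where
  "closed_nbhd G v = insert v {u. (v, u) \<in> parcs G}"

primrec power_dom_step :: "'a pair_pre_digraph \<Rightarrow> nat \<Rightarrow> 'a set \<Rightarrow> nat \<Rightarrow> 'a set" where
  "power_dom_step G k D 0 = (\<Union>v\<in>D. closed_nbhd G v)"
| "power_dom_step G k D (Suc i) =
    \<Union>{closed_nbhd G v | v. v \<in> power_dom_step G k D i \<and>
                            card (closed_nbhd G v - power_dom_step G k D i) \<le> k}"

definition power_dom_limit :: "'a pair_pre_digraph \<Rightarrow> nat \<Rightarrow> 'a set \<Rightarrow> 'a set" where
  "power_dom_limit G k D = (\<Union>i. power_dom_step G k D i)"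

definition power_dominating_set :: "'a pair_pre_digraph \<Rightarrow> nat \<Rightarrow> 'a set \<Rightarrow> bool" where
  "power_dominating_set G k D \<longleftrightarrow> D \<subseteq> pverts G \<and> power_dom_limit G k D = pverts G"

definition power_dom_number :: "'a pair_pre_digraph \<Rightarrow> nat \<Rightarrow> nat" where
  "power_dom_number G k = Min (card ` {D. power_dominating_set G k D})"

lemma power_dom_step_closed_nbhd:
  assumes "x \<in> power_dom_step G k D i"
  shows "\<exists>v. x \<in> closed_nbhd G v \<and> v \<in> power_dom_step G k D i \<and>
             closed_nbhd G v \<subseteq> power_dom_step G k D i"
proof (cases i)
  case 0
  with assms obtain v where "v \<in> D" "x \<in> closed_nbhd G v" by auto
  moreover have "v \<in> closed_nbhd G v" by (simp add: closed_nbhd_def)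
  ultimately show ?thesis using 0 by auto
next
  case (Suc j)
  with assms obtain v where v: "x \<in> closed_nbhd G v" "v \<in> power_dom_step G k D j"
      "card (closed_nbhd G v - power_dom_step G k D j) \<le> k"
    by auto
  then have "closed_nbhd G v \<subseteq> power_dom_step G k D i" using Suc by auto
  moreover have "v \<in> closed_nbhd G v" by (simp add: closed_nbhd_def)
  ultimately show ?thesis using v by blast
qed

lemma power_dom_step_Suc: "power_dom_step G k D i \<subseteq> power_dom_step G k D (Suc i)"
proof
  fix x assume "x \<in> power_dom_step G k D i"
  from power_dom_step_closed_nbhd[OF this] obtain v where v: "x \<in> closed_nbhd G v" "v \<in> power_dom_step G k D i"
      "closed_nbhd G v \<subseteq> power_dom_step G k D i"
    by blast
  then have "closed_nbhd G v - power_dom_step G k D i = {}" by blast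
  then have "card (closed_nbhd G v - power_dom_step G k D i) \<le> k" by (metis card.empty le0)
  with v(1,2) show "x \<in> power_dom_step G k D (Suc i)"
    unfolding power_dom_step.simps by blast
qed

lemma power_dom_step_mono: "mono (power_dom_step G k D)"
  unfolding mono_iff_le_Suc by (intro allI power_dom_step_Suc)

lemma power_dom_step_subset:
  assumes "pair_wf_digraph G" "D \<subseteq> pverts G"
  shows "power_dom_step G k D i \<subseteq> pverts G"
proof -
  interpret pair_wf_digraph G by fact
  have *: "closed_nbhd G v \<subseteq> pverts G" if "v \<in> pverts G" for v
    using that in_arcsD2 by (auto simp: closed_nbhd_def)
  show ?thesis
  proof (induction i)
    case 0
    show ?case using * assms(2) by auto
  next
    case (Suc i)
    then show ?case using * by auto
  qed
qed

lemma power_dom_step_stabilizes: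
  assumes "pair_fin_digraph G" "D \<subseteq> pverts G"
  shows "\<exists>n. \<forall>i\<ge>n. power_dom_step G k D i = power_dom_limit G k D"
proof -
  interpret pair_fin_digraph G by fact
  have sub: "power_dom_step G k D i \<subseteq> pverts G" for i
    by (rule power_dom_step_subset) (use assms(2) pair_wf_digraph_axioms in auto)
  have "finite (range (power_dom_step G k D))"
    by (rule finite_subset[of _ "Pow (pverts G)"]) (use sub pair_finite_verts in auto)
  then have "\<Union> (range (power_dom_step G k D)) \<in> range (power_dom_step G k D)"
  proof (rule finite_Sup_in)
    show "range (power_dom_step G k D) \<noteq> {}" by simp
    fix X Y assume "X \<in> range (power_dom_step G k D)" "Y \<in> range (power_dom_step G k D)"
    then obtain i j where ij: "X = power_dom_step G k D i" "Y = power_dom_step G k D j" by blast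
    have "X \<union> Y = power_dom_step G k D (max i j)"
    proof (cases "i \<le> j")
      case True
      then show ?thesis
        using monoD[OF power_dom_step_mono True, of G k D] by (simp add: ij max_def sup_absorb2)
    next
      case False
      then have "j \<le> i" by simp
      from monoD[OF power_dom_step_mono this, of G k D] False show ?thesis
        by (simp add: ij max_def sup_absorb1)
    qed
    then show "X \<union> Y \<in> range (power_dom_step G k D)" by blast
  qed
  then obtain n where n: "power_dom_limit G k D = power_dom_step G k D n"
    by (auto simp: power_dom_limit_def)
  have "power_dom_step G k D i = power_dom_limit G k D" if "i \<ge> n" for i
    using monoD[OF power_dom_step_mono that, of G k D] n by (auto simp: power_dom_limit_def)
  then show ?thesis by blast
qed

text \<open>The minimum ranges over a finite nonempty set: the whole vertex set is always dominating.\<close>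

lemma power_dominating_set_verts:
  assumes "pair_wf_digraph G"
  shows "power_dominating_set G k (pverts G)"
proof -
  have "pverts G \<subseteq> power_dom_step G k (pverts G) 0" by (auto simp: closed_nbhd_def)
  then show ?thesis
    using power_dom_step_subset[OF assms subset_refl, of k]
    unfolding power_dominating_set_def power_dom_limit_def by blast
qed

lemma finite_power_dominating_sets:
  assumes "pair_fin_digraph G"
  shows "finite {D. power_dominating_set G k D}"
  by (rule finite_subset[of _ "Pow (pverts G)"])
     (auto simp: power_dominating_set_def pair_fin_digraph.pair_finite_verts[OF assms])

end

theory Submission
  imports Defs
begin

text \<open>
  For \<open>k \<ge> 2\<close> a single corner suffices: once a copy is observed, the vertex it shares with another
  copy has only its two neighbours there left to observe, so the propagation enters that copy at a
  corner.

  For \<open>k = 1\<close> the midpoints of the sides of any copy of \<open>S\<^sub>2\<close> form a fort (no vertex outside has exactly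
  one neighbour in it), so a power dominating set meets each of the \<open>3 ^ (g - 2)\<close> copies of \<open>S\<^sub>2\<close>;
  since a vertex lies in at most two copies and \<open>3 ^ (g - 2)\<close> is odd, the lower bound follows.
  Conversely, for two corners \<open>p\<close>, \<open>q\<close> there is a set of \<open>(3 ^ (g - 2) + 1) / 2\<close> vertices containing \<open>p\<close>
  that observes everything once \<open>q\<close> is observed: one chooses such sets in the three copies so that
  the sets of two copies share a vertex and each copy, when completed, supplies the observed corner
  of the next. A power dominating set is assembled in the same way from one in the first copy.
\<close>

section \<open>Labels, corners and the embeddings of the copies\<close>

definition labels :: "nat set" where
  "labels = {1, 2, 3}"

lemma labels_simps [simp]:
  "1 \<in> labels" "Suc 0 \<in> labels" "2 \<in> labels" "3 \<in> labels" "finite labels" "card labels = 3"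
  by (auto simp: labels_def)

lemma third_label:
  assumes "p \<in> labels" "q \<in> labels" "p \<noteq> q"
  obtains r where "r \<in> labels" "r \<noteq> p" "r \<noteq> q" "labels = {p, q, r}"
  using assms unfolding labels_def by fastforce

abbreviation verts_S :: "nat \<Rightarrow> nat list set" where
  "verts_S g \<equiv> pverts (sierpinski g)"

abbreviation nbhd_S :: "nat \<Rightarrow> nat list \<Rightarrow> nat list set" where
  "nbhd_S g \<equiv> closed_nbhd (sierpinski g)"

definition corners :: "nat \<Rightarrow> nat list set" where
  "corners g = (\<lambda>t. outmost t g) ` labels"

definition place :: "nat \<Rightarrow> nat \<Rightarrow> nat list \<Rightarrow> nat list" where
  "place g t v = identify (outmost 1 g) (outmost 2 g) (outmost 3 g) (t # v)"

section \<open>Copies inside the next Sierpinski graph\<close>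

lemma outmost_eq_iff: "0 < g \<Longrightarrow> outmost s g = outmost t g \<longleftrightarrow> s = t"
  by (cases g) auto

text \<open>All three identifications obey one rule: corner \<open>s\<close> of copy
  \<open>t\<close> is corner \<open>t\<close> of copy \<open>s\<close>. This symmetry lets later
  arguments use arbitrary labels instead of treating the three gluings separately.\<close>

lemma place_eq_iff:
  assumes "0 < g" "t \<in> labels" "s \<in> labels"
  shows "place g t v = place g s w \<longleftrightarrow>
    t = s \<and> v = w \<or> t \<noteq> s \<and> v = outmost s g \<and> w = outmost t g"
proof -
  have "distinct [outmost 1 g, outmost 2 g, outmost 3 g]"
    using assms(1) by (simp add: outmost_eq_iff)
  from identify_eq_iff[OF this] show ?thesis
    unfolding place_def using assms(2,3) unfolding labels_def
    by (elim insertE emptyE; simp only: doubleton_eq_iff list.inject; simp; blast)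
qed

lemma inj_place: "0 < g \<Longrightarrow> t \<in> labels \<Longrightarrow> inj_on (place g t) A"
  by (intro inj_onI) (simp add: place_eq_iff)

lemma place_shared:
  "0 < g \<Longrightarrow> t \<in> labels \<Longrightarrow> s \<in> labels \<Longrightarrow> place g t (outmost s g) = place g s (outmost t g)"
  by (cases "s = t") (auto simp: place_eq_iff)

lemma place_outmost: "0 < g \<Longrightarrow> t \<in> labels \<Longrightarrow> place g t (outmost t g) = outmost t (Suc g)"
  unfolding place_def identify_def by (auto simp: outmost_eq_iff labels_def)

lemma sierpinski_Suc:
  "0 < g \<Longrightarrow> sierpinski (Suc g) =
    glue_copies (outmost 1 g) (outmost 2 g) (outmost 3 g) (sierpinski g)"
  by (cases g) auto

lemma verts_S_Suc: "0 < g \<Longrightarrow> verts_S (Suc g) = (\<Union>t\<in>labels. place g t ` verts_S g)"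
  unfolding sierpinski_Suc glue_copies_def place_def labels_def by auto

lemma arcs_S_Suc:
  "0 < g \<Longrightarrow> (x, y) \<in> parcs (sierpinski (Suc g)) \<longleftrightarrow>
    (\<exists>t\<in>labels. \<exists>u v. x = place g t u \<and> y = place g t v \<and> (u, v) \<in> parcs (sierpinski g))"
  unfolding sierpinski_Suc glue_copies_def place_def labels_def by auto

lemma finite_verts_S: "finite (verts_S g)"
proof -
  interpret pair_graph "sierpinski g" by (rule pair_graph_sierpinski)
  show ?thesis by (rule pair_finite_verts)
qed

lemma pair_wf_digraph_sierpinski: "pair_wf_digraph (sierpinski g)"
proof -
  interpret pair_graph "sierpinski g" by (rule pair_graph_sierpinski)
  show ?thesis by (rule pair_wf_digraph_axioms)
qed

lemma nbhd_S_subset: "v \<in> verts_S g \<Longrightarrow> nbhd_S g v \<subseteq> verts_S g"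
  using pair_wf_digraph.in_arcsD2[OF pair_wf_digraph_sierpinski] unfolding closed_nbhd_def by auto

lemma nbhd_S_sym: "u \<in> nbhd_S g v \<Longrightarrow> v \<in> nbhd_S g u"
proof -
  interpret pair_graph "sierpinski g" by (rule pair_graph_sierpinski)
  show "u \<in> nbhd_S g v \<Longrightarrow> v \<in> nbhd_S g u"
    unfolding closed_nbhd_def by (auto simp: arcs_symmetric)
qed

text \<open>Each preimage of \<open>x\<close> contributes its own neighbourhood; the inserted
  \<open>x\<close> accounts for words without a preimage, for which the union is empty.\<close>

lemma nbhd_S_Suc:
  assumes "0 < g"
  shows "nbhd_S (Suc g) x = insert x (\<Union>s\<in>labels. \<Union>w\<in>{w. place g s w = x}. place g s ` nbhd_S g w)"
  unfolding closed_nbhd_def arcs_S_Suc[OF assms] by blast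

lemma place_nbhd_subset:
  assumes "0 < g" "t \<in> labels"
  shows "place g t ` nbhd_S g v \<subseteq> nbhd_S (Suc g) (place g t v)"
  using assms(2) unfolding nbhd_S_Suc[OF assms(1)] by blast

lemma nbhd_place:
  assumes "0 < g" "t \<in> labels" and v: "\<And>s. s \<in> labels \<Longrightarrow> s \<noteq> t \<Longrightarrow> v \<noteq> outmost s g"
  shows "nbhd_S (Suc g) (place g t v) = place g t ` nbhd_S g v"
proof
  have "s = t \<and> w = v" if "s \<in> labels" "place g s w = place g t v" for s w
    using that v[of s] assms(1,2) by (auto simp only: place_eq_iff)
  moreover have "v \<in> nbhd_S g v" by (simp add: closed_nbhd_def)
  ultimately show "nbhd_S (Suc g) (place g t v) \<subseteq> place g t ` nbhd_S g v"
    unfolding nbhd_S_Suc[OF assms(1)] by blast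
qed (rule place_nbhd_subset[OF assms(1,2)])

lemma nbhd_place_shared:
  assumes "0 < g" "t \<in> labels" "s \<in> labels" "s \<noteq> t"
  shows "nbhd_S (Suc g) (place g t (outmost s g)) =
    place g t ` nbhd_S g (outmost s g) \<union> place g s ` nbhd_S g (outmost t g)"
proof
  have *: "r = t \<and> w = outmost s g \<or> r = s \<and> w = outmost t g"
    if "r \<in> labels" "place g r w = place g t (outmost s g)" for r w
    using that assms by (auto simp only: place_eq_iff outmost_eq_iff)
  have "outmost s g \<in> nbhd_S g (outmost s g)" by (simp add: closed_nbhd_def)
  then show "nbhd_S (Suc g) (place g t (outmost s g)) \<subseteq>
    place g t ` nbhd_S g (outmost s g) \<union> place g s ` nbhd_S g (outmost t g)"
    unfolding nbhd_S_Suc[OF assms(1)] using * by blast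
  show "place g t ` nbhd_S g (outmost s g) \<union> place g s ` nbhd_S g (outmost t g) \<subseteq>
    nbhd_S (Suc g) (place g t (outmost s g))"
    using place_nbhd_subset[OF assms(1,2), of "outmost s g"]
      place_nbhd_subset[OF assms(1,3), of "outmost t g"] place_shared[OF assms(1-3)] by simp
qed

lemma nbhd_place_interior:
  assumes "0 < g" "t \<in> labels" "v \<notin> corners g"
  shows "nbhd_S (Suc g) (place g t v) = place g t ` nbhd_S g v"
  by (rule nbhd_place[OF assms(1,2)]) (use assms(3) in \<open>auto simp: corners_def\<close>)

lemma place_in_corners_iff:
  assumes "0 < g" "t \<in> labels"
  shows "place g t v \<in> corners (Suc g) \<longleftrightarrow> v = outmost t g"
proof -
  have "place g t v \<in> corners (Suc g) \<longleftrightarrow> (\<exists>s\<in>labels. place g t v = place g s (outmost s g))"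
    unfolding corners_def image_iff using place_outmost[OF assms(1)] by auto
  also have "\<dots> \<longleftrightarrow> v = outmost t g"
    using assms by (auto simp only: place_eq_iff outmost_eq_iff)
  finally show ?thesis .
qed

lemma verts_S_1: "verts_S 1 = (\<lambda>s. [s]) ` labels"
  unfolding labels_def by auto

lemma outmost_in_verts_S: "0 < g \<Longrightarrow> t \<in> labels \<Longrightarrow> outmost t g \<in> verts_S g"
proof (induction g)
  case (Suc g)
  show ?case
  proof (cases "g = 0")
    case True
    then show ?thesis using Suc.prems verts_S_1 by simp
  next
    case False
    then have "place g t (outmost t g) \<in> verts_S (Suc g)"
      using Suc verts_S_Suc[of g] by blast
    then show ?thesis using False Suc.prems by (simp add: place_outmost)
  qed
qed simp

lemma nbhd_S_1: "v \<in> verts_S 1 \<Longrightarrow> nbhd_S 1 v = verts_S 1"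
  unfolding closed_nbhd_def by auto

section \<open>Propagation and closed sets\<close>

text \<open>Corners are not required to force, because inside a larger graph they acquire additional
  neighbours; this makes the notion stable under restriction to a copy.\<close>

definition forcing_closed :: "nat \<Rightarrow> nat \<Rightarrow> nat list set \<Rightarrow> bool" where
  "forcing_closed k g X \<longleftrightarrow> (\<forall>v \<in> X \<inter> verts_S g - corners g.
    card (nbhd_S g v - X) \<le> k \<longrightarrow> nbhd_S g v \<subseteq> X)"

text \<open>A non-corner of a copy keeps its neighbourhood up to the injection
  \<open>place g t\<close>, so it has equally many unobserved neighbours in the copy and in the next
  graph. The inductions for the upper bounds rest on this.\<close>

lemma forcing_closed_vimage_place:
  assumes "0 < g" "t \<in> labels" "forcing_closed k (Suc g) X"
  shows "forcing_closed k g (place g t -` X)"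
  unfolding forcing_closed_def
proof (intro ballI impI)
  fix v assume v: "v \<in> place g t -` X \<inter> verts_S g - corners g"
    and c: "card (nbhd_S g v - place g t -` X) \<le> k"
  have n: "nbhd_S (Suc g) (place g t v) = place g t ` nbhd_S g v"
    using nbhd_place_interior assms v by blast
  have "v \<noteq> outmost t g" using v assms(2) by (auto simp: corners_def)
  then have "place g t v \<in> X \<inter> verts_S (Suc g) - corners (Suc g)"
    using v assms place_in_corners_iff[OF assms(1,2)] by (auto simp: verts_S_Suc)
  moreover have "nbhd_S (Suc g) (place g t v) - X = place g t ` (nbhd_S g v - place g t -` X)"
    unfolding n by auto
  then have "card (nbhd_S (Suc g) (place g t v) - X) \<le> k"
    using c card_image[OF inj_place[OF assms(1,2)]] by metis
  ultimately have "nbhd_S (Suc g) (place g t v) \<subseteq> X"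
    using assms(3) unfolding forcing_closed_def by blast
  then show "nbhd_S g v \<subseteq> place g t -` X" unfolding n by auto
qed

text \<open>The limit of the propagation is itself a forcing-closed set containing the
  neighbourhoods of \<open>D\<close>, hence one of the sets \<open>X\<close> in the premise.\<close>

lemma power_dominating_setI:
  assumes D: "D \<subseteq> verts_S g"
    and *: "\<And>X. (\<Union>v\<in>D. nbhd_S g v) \<subseteq> X \<Longrightarrow> forcing_closed k g X \<Longrightarrow> verts_S g \<subseteq> X"
  shows "power_dominating_set (sierpinski g) k D"
proof -
  interpret pair_graph "sierpinski g" by (rule pair_graph_sierpinski)
  let ?L = "power_dom_limit (sierpinski g) k D"
  from power_dom_step_stabilizes[OF pair_fin_digraph_axioms D]
  obtain n where "\<forall>i\<ge>n. power_dom_step (sierpinski g) k D i = ?L" ..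
  then have n: "power_dom_step (sierpinski g) k D n = ?L" by simp
  have sub: "power_dom_step (sierpinski g) k D i \<subseteq> ?L" for i
    unfolding power_dom_limit_def by blast
  have "forcing_closed k g ?L"
    unfolding forcing_closed_def
  proof (intro ballI impI)
    fix v assume "v \<in> ?L \<inter> verts_S g - corners g" "card (nbhd_S g v - ?L) \<le> k"
    \<comment> \<open>Stage \<open>n\<close> already equals the limit, so \<open>v\<close> forces at
      that stage.\<close>
    then have "nbhd_S g v \<subseteq> power_dom_step (sierpinski g) k D (Suc n)"
      using n by auto
    then show "nbhd_S g v \<subseteq> ?L" using sub by blast
  qed
  moreover have "(\<Union>v\<in>D. nbhd_S g v) \<subseteq> ?L" using sub[of 0] by simp
  ultimately have "verts_S g \<subseteq> ?L" by (rule *[rotated])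
  moreover have "?L \<subseteq> verts_S g"
    unfolding power_dom_limit_def
    using power_dom_step_subset[OF pair_wf_digraph_sierpinski D] by blast
  ultimately show ?thesis using D unfolding power_dominating_set_def by blast
qed

lemma power_dom_number_eqI:
  assumes "power_dominating_set (sierpinski g) k D" "card D \<le> m"
    and "\<And>E. power_dominating_set (sierpinski g) k E \<Longrightarrow> m \<le> card E"
  shows "power_dom_number (sierpinski g) k = m"
proof -
  interpret pair_graph "sierpinski g" by (rule pair_graph_sierpinski)
  have "card D = m" using assms by (meson le_antisym)
  then show ?thesis
    unfolding power_dom_number_def
    using assms finite_power_dominating_sets[OF pair_fin_digraph_axioms, of k]
    by (intro Min_eqI) auto
qed

lemma power_dominating_set_card_pos:
  assumes "0 < g" "power_dominating_set (sierpinski g) k D"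
  shows "1 \<le> card D"
proof -
  have "power_dom_step (sierpinski g) k {} i = {}" for i by (induction i) auto
  then have "power_dom_limit (sierpinski g) k {} = {}" unfolding power_dom_limit_def by simp
  then have "D \<noteq> {}"
    using assms(2) outmost_in_verts_S[OF assms(1), of 1] unfolding power_dominating_set_def by auto
  moreover have "finite D"
    using assms(2) finite_verts_S finite_subset unfolding power_dominating_set_def by metis
  ultimately show ?thesis by (simp add: Suc_leI card_gt_0_iff)
qed

section \<open>The case of at least two forced neighbours\<close>

text \<open>A corner keeps degree two at every stage, because corner \<open>t\<close> of copy
  \<open>t\<close> is never glued.\<close>

lemma card_nbhd_outmost:
  assumes "0 < g" "t \<in> labels"
  shows "finite (nbhd_S g (outmost t g)) \<and> card (nbhd_S g (outmost t g)) = 3"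
  using assms(1)
proof (induction g)
  case (Suc g)
  show ?case
  proof (cases "g = 0")
    case True
    then show ?thesis using nbhd_S_1[OF outmost_in_verts_S, of t] assms(2)
      by (auto simp: verts_S_1 card_image inj_on_def simp flip: One_nat_def)
  next
    case False
    then have g: "0 < g" by simp
    have "nbhd_S (Suc g) (place g t (outmost t g)) = place g t ` nbhd_S g (outmost t g)"
      using nbhd_place[OF g assms(2)] outmost_eq_iff[OF g] by metis
    then show ?thesis
      using Suc g assms(2) card_image[OF inj_place[OF g assms(2)]]
      by (metis finite_imageI place_outmost)
  qed
qed simp

text \<open>The disjunction covers both situations with value 1: the triangle for any
  \<open>k\<close>, and every graph for \<open>2 \<le> k\<close>. Beyond the triangle it reduces to
  \<open>2 \<le> k\<close>.\<close>

lemma spread_from_outmost: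
  assumes "0 < g" "2 \<le> k \<or> g = 1" "forcing_closed k g X" "nbhd_S g (outmost 1 g) \<subseteq> X"
  shows "verts_S g \<subseteq> X"
  using assms
proof (induction g arbitrary: X)
  case (Suc g)
  show ?case
  proof (cases "g = 0")
    case True
    then show ?thesis using Suc.prems(4) nbhd_S_1[OF outmost_in_verts_S, of 1] by simp
  next
    case False
    then have g: "0 < g" and k: "2 \<le> k \<or> g = 1" and k2: "2 \<le> k" using Suc.prems(2) by auto
    have copy: "place g t ` verts_S g \<subseteq> X"
      if t: "t \<in> labels" and "place g t ` nbhd_S g (outmost 1 g) \<subseteq> X" for t
      using Suc.IH[OF g k forcing_closed_vimage_place[OF g t Suc.prems(3)]] that(2) by blast
    have one: "place g 1 ` verts_S g \<subseteq> X"
      using copy[of 1] Suc.prems(4) place_nbhd_subset[OF g, of 1 "outmost 1 g"] place_outmost[OF g, of 1]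
      by auto
    \<comment> \<open>Copy \<open>s\<close> meets copy 1 in its own corner 1, which is where the
      induction hypothesis starts.\<close>
    have "place g s ` verts_S g \<subseteq> X" if s: "s \<in> labels" "s \<noteq> 1" for s
    proof (rule copy[OF s(1)])
      let ?x = "place g 1 (outmost s g)" and ?N = "nbhd_S g (outmost 1 g)"
      have x: "?x = place g s (outmost 1 g)" using place_shared[OF g, of 1 s] s by simp
      have V: "outmost s g \<in> verts_S g" using outmost_in_verts_S[OF g s(1)] .
      have n: "nbhd_S (Suc g) ?x = place g 1 ` nbhd_S g (outmost s g) \<union> place g s ` ?N"
        using nbhd_place_shared[OF g, of 1 s] s by simp
      have xX: "?x \<in> X" using one V by blast
      \<comment> \<open>Copy 1 is observed, so only the two neighbours of \<open>?x\<close> inside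
        copy \<open>s\<close> can be missing.\<close>
      have "nbhd_S (Suc g) ?x - X \<subseteq> place g s ` (?N - {outmost 1 g})"
        using one nbhd_S_subset[OF V] xX x unfolding n by auto
      moreover have "outmost 1 g \<in> ?N" by (simp add: closed_nbhd_def)
      then have "card (place g s ` (?N - {outmost 1 g})) = 2"
        using card_nbhd_outmost[OF g, of 1] card_image[OF inj_place[OF g s(1)]]
        by (simp add: card_Diff_singleton)
      moreover have "finite (place g s ` (?N - {outmost 1 g}))"
        using card_nbhd_outmost[OF g, of 1] by simp
      ultimately have "card (nbhd_S (Suc g) ?x - X) \<le> k"
        using k2 by (metis card_mono le_trans)
      moreover have "?x \<in> X \<inter> verts_S (Suc g) - corners (Suc g)"
        using xX V s g place_in_corners_iff[OF g, of 1 "outmost s g"]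
        by (auto simp: verts_S_Suc outmost_eq_iff)
      ultimately have "nbhd_S (Suc g) ?x \<subseteq> X"
        using Suc.prems(3) unfolding forcing_closed_def by blast
      then show "place g s ` ?N \<subseteq> X" unfolding n by blast
    qed
    with one show ?thesis unfolding verts_S_Suc[OF g] by blast
  qed
qed simp

lemma power_dom_number_eq_1:
  assumes "0 < g" "2 \<le> k \<or> g = 1"
  shows "power_dom_number (sierpinski g) k = 1"
proof (rule power_dom_number_eqI)
  show "power_dominating_set (sierpinski g) k {outmost 1 g}"
    using spread_from_outmost[OF assms] outmost_in_verts_S[OF assms(1), of 1]
    by (intro power_dominating_setI) auto
qed (use power_dominating_set_card_pos assms in auto)

section \<open>Upper bound for one forced neighbour\<close>

text \<open>\<open>Q\<close> lists vertices observed from outside for free; unlike those of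
  \<open>D\<close>, they do not bring their neighbourhoods along. The case \<open>Q = {}\<close>
  yields power dominating sets for \<open>k = 1\<close>.\<close>

definition spreads :: "nat \<Rightarrow> nat list set \<Rightarrow> nat list set \<Rightarrow> bool" where
  "spreads g D Q \<longleftrightarrow> D \<subseteq> verts_S g \<and>
    (\<forall>X. (\<Union>v\<in>D. nbhd_S g v) \<union> Q \<subseteq> X \<longrightarrow> forcing_closed 1 g X \<longrightarrow> verts_S g \<subseteq> X)"

lemma spreads_place:
  assumes "0 < g" "t \<in> labels" "spreads g D Q" "forcing_closed 1 (Suc g) X"
    and D: "(\<Union>v\<in>place g t ` D. nbhd_S (Suc g) v) \<subseteq> X" and Q: "place g t ` Q \<subseteq> X"
  shows "place g t ` verts_S g \<subseteq> X"
proof -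
  have "(\<Union>v\<in>D. nbhd_S g v) \<union> Q \<subseteq> place g t -` X"
  proof (intro Un_least UN_least)
    show "nbhd_S g v \<subseteq> place g t -` X" if "v \<in> D" for v
    proof -
      have "place g t ` nbhd_S g v \<subseteq> X"
        using that D place_nbhd_subset[OF assms(1,2), of v] by fastforce
      then show ?thesis by blast
    qed
    show "Q \<subseteq> place g t -` X" using Q by blast
  qed
  then have "verts_S g \<subseteq> place g t -` X"
    using assms(3) forcing_closed_vimage_place[OF assms(1,2,4)] unfolding spreads_def by blast
  then show ?thesis by blast
qed

section \<open>The second graph: its six vertices \<open>place 1 p [q]\<close> as unordered pairs of
  labels\<close>

lemma place_verts_S_1:
  assumes "labels = {p, q, r}"
  shows "place 1 t ` verts_S 1 = {place 1 t [p], place 1 t [q], place 1 t [r]}"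
  unfolding verts_S_1 assms image_insert image_empty ..

lemma place_1_sym: "p \<in> labels \<Longrightarrow> q \<in> labels \<Longrightarrow> place 1 p [q] = place 1 q [p]"
  by (auto simp: place_eq_iff)

lemma verts_S_2: "verts_S 2 = (\<Union>t\<in>labels. place 1 t ` verts_S 1)"
  using verts_S_Suc[of 1] unfolding Suc_1 by simp

lemma place_1_in_verts_S_2: "p \<in> labels \<Longrightarrow> q \<in> labels \<Longrightarrow> place 1 p [q] \<in> verts_S 2"
  unfolding verts_S_2 verts_S_1 by blast

text \<open>The vertex with labels \<open>p\<close>, \<open>q\<close> lies in triangles
  \<open>p\<close> and \<open>q\<close>; these coincide when it is a corner.\<close>

lemma nbhd_S_2:
  assumes "p \<in> labels" "q \<in> labels"
  shows "nbhd_S 2 (place 1 p [q]) = place 1 p ` verts_S 1 \<union> place 1 q ` verts_S 1"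
proof -
  have N: "nbhd_S 1 (outmost r 1) = verts_S 1" if "r \<in> labels" for r
    using nbhd_S_1[OF outmost_in_verts_S] that by simp
  have "nbhd_S 2 (place 1 p (outmost q 1)) = place 1 p ` verts_S 1 \<union> place 1 q ` verts_S 1"
  proof (cases "q = p")
    case True
    then show ?thesis using nbhd_place[of 1 p "outmost p 1"] N[of p] assms
      unfolding Suc_1 by (simp add: outmost_eq_iff)
  next
    case False
    then show ?thesis using nbhd_place_shared[of 1 p q] N[of p] N[of q] assms
      unfolding Suc_1 by simp
  qed
  then show ?thesis by simp
qed

lemma place_1_in_corners_iff:
  assumes "p \<in> labels" "q \<in> labels"
  shows "place 1 p [q] \<in> corners 2 \<longleftrightarrow> p = q"
  using place_in_corners_iff[of 1 p "[q]"] assms unfolding Suc_1 by auto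

text \<open>The midpoint shared by triangles \<open>p\<close> and \<open>q\<close> forces as soon as
  \<open>y\<close> is the only candidate left unobserved.\<close>

lemma force_2:
  assumes X: "forcing_closed 1 2 X" and pq: "p \<in> labels" "q \<in> labels" "p \<noteq> q"
    and x: "place 1 p [q] \<in> X"
    and sub: "place 1 p ` verts_S 1 \<union> place 1 q ` verts_S 1 \<subseteq> insert y X"
  shows "place 1 p ` verts_S 1 \<union> place 1 q ` verts_S 1 \<subseteq> X"
proof -
  have "card (nbhd_S 2 (place 1 p [q]) - X) \<le> card {y}"
    using sub unfolding nbhd_S_2[OF pq(1,2)] by (intro card_mono) auto
  then have "nbhd_S 2 (place 1 p [q]) \<subseteq> X"
    using X x pq place_1_in_verts_S_2[OF pq(1,2)] place_1_in_corners_iff[OF pq(1,2)]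
    unfolding forcing_closed_def by simp
  then show ?thesis unfolding nbhd_S_2[OF pq(1,2)] .
qed

lemma spreads_2_outmost:
  assumes "p \<in> labels" "q \<in> labels" "p \<noteq> q"
  shows "spreads 2 {outmost p 2} {outmost q 2}"
  unfolding spreads_def
proof (intro conjI allI impI)
  show "{outmost p 2} \<subseteq> verts_S 2" using outmost_in_verts_S[of 2 p] assms by simp
  fix X assume "(\<Union>v\<in>{outmost p 2}. nbhd_S 2 v) \<union> {outmost q 2} \<subseteq> X" and X: "forcing_closed 1 2 X"
  moreover have out: "outmost t 2 = place 1 t [t]" if "t \<in> labels" for t
    using place_outmost[of 1 t] that unfolding Suc_1 by simp
  ultimately have p: "place 1 p ` verts_S 1 \<subseteq> X" and q: "place 1 q [q] \<in> X"
    using assms nbhd_S_2[of p p] by auto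
  obtain r where r: "r \<in> labels" "r \<noteq> p" "r \<noteq> q" and L: "labels = {p, q, r}"
    using third_label assms by blast
  note P = place_verts_S_1[OF L]
  \<comment> \<open>Triangle \<open>p\<close> is dominated and corner \<open>q\<close> is given, so
    the midpoint of \<open>p\<close> and \<open>q\<close> can miss only the midpoint of
    \<open>q\<close> and \<open>r\<close>.\<close>
  have "place 1 p ` verts_S 1 \<union> place 1 q ` verts_S 1 \<subseteq> X"
    using force_2[OF X assms, of "place 1 q [r]"] p q place_1_sym[OF assms(1,2)] unfolding P by auto
  then have q': "place 1 q ` verts_S 1 \<subseteq> X" by simp
  \<comment> \<open>The midpoint of \<open>p\<close> and \<open>r\<close> now misses at most corner
    \<open>r\<close>.\<close>
  have "place 1 p ` verts_S 1 \<union> place 1 r ` verts_S 1 \<subseteq> X"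
    using force_2[OF X assms(1) r(1), of "place 1 r [r]"] r p q' place_1_sym[OF assms(1) r(1)]
      place_1_sym[OF assms(2) r(1)] unfolding P by auto
  with q' show "verts_S 2 \<subseteq> X" unfolding verts_S_2 L by auto
qed

text \<open>The midpoint of labels 1 and 2 dominates everything but corner 3, which the midpoint of
  1 and 3 then forces.\<close>

lemma spreads_2_midpoint: "spreads 2 {place 1 1 [2]} {}"
  unfolding spreads_def
proof (intro conjI allI impI)
  show "{place 1 1 [2]} \<subseteq> verts_S 2" using place_1_in_verts_S_2[of 1 2] by simp
  fix X assume "(\<Union>v\<in>{place 1 1 [2]}. nbhd_S 2 v) \<union> {} \<subseteq> X" and X: "forcing_closed 1 2 X"
  then have N: "place 1 1 ` verts_S 1 \<subseteq> X" "place 1 2 ` verts_S 1 \<subseteq> X"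
    using nbhd_S_2[of 1 2] by (auto simp del: One_nat_def)
  note P = place_verts_S_1[OF labels_def]
  have "place 1 1 ` verts_S 1 \<union> place 1 3 ` verts_S 1 \<subseteq> X"
    using force_2[OF X, of 1 3 "place 1 3 [3]"] N place_1_sym[of 1 3] place_1_sym[of 2 3]
    unfolding P by (auto simp del: One_nat_def)
  with N show "verts_S 2 \<subseteq> X" unfolding verts_S_2 labels_def by (auto simp del: One_nat_def)
qed

section \<open>Assembling spreading sets from three copies\<close>

lemma card_shared_union:
  assumes "finite A" "finite B" "x \<in> A" "x \<in> B"
  shows "card (A \<union> B) + 1 \<le> card A + card B"
proof -
  have "0 < card (A \<inter> B)" using assms by (auto simp: card_gt_0_iff)
  then show ?thesis using card_Un_Int[OF assms(1,2)] by simp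
qed

lemma spreads_subset: "spreads g D Q \<Longrightarrow> D \<subseteq> verts_S g"
  unfolding spreads_def by simp

lemma spreads_finite: "spreads g D Q \<Longrightarrow> finite D"
  using spreads_subset finite_verts_S by (rule finite_subset)

text \<open>Three sets of doubled size at most \<open>3 ^ n + 1\<close> give
  \<open>3 ^ Suc n + 3\<close>, and the one shared vertex saves 2. Containing corner
  \<open>p\<close> is what allows sharing at the next stage.\<close>

lemma ex_spreads_outmost:
  assumes "p \<in> labels" "q \<in> labels" "p \<noteq> q"
  shows "\<exists>D. spreads (n + 2) D {outmost q (n + 2)} \<and> outmost p (n + 2) \<in> D \<and> 2 * card D \<le> 3 ^ n + 1"
  using assms
proof (induction n arbitrary: p q)
  case 0
  have "0 + 2 = (2 :: nat)" by simp
  then show ?case using 0 spreads_2_outmost[of p q]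
    by (intro exI[of _ "{outmost p 2}"]) (simp only:, simp)
next
  case (Suc n)
  define g where "g = n + 2"
  have g: "0 < g" "Suc n + 2 = Suc g" by (auto simp: g_def)
  obtain r where r: "r \<in> labels" "r \<noteq> p" "r \<noteq> q" and L: "labels = {p, q, r}"
    using third_label Suc.prems by blast
  \<comment> \<open>The sets of copies \<open>q\<close> and \<open>r\<close> contain the vertex
    common to both copies, while that of copy \<open>p\<close> contains the required corner.\<close>
  obtain D\<^sub>q where q: "spreads g D\<^sub>q {outmost q g}" "outmost r g \<in> D\<^sub>q" "2 * card D\<^sub>q \<le> 3 ^ n + 1"
    using Suc.IH[of r q] Suc.prems r unfolding g_def by blast
  obtain D\<^sub>p where p: "spreads g D\<^sub>p {outmost q g}" "outmost p g \<in> D\<^sub>p" "2 * card D\<^sub>p \<le> 3 ^ n + 1"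
    using Suc.IH[of p q] Suc.prems r unfolding g_def by blast
  obtain D\<^sub>r where r': "spreads g D\<^sub>r {outmost p g}" "outmost q g \<in> D\<^sub>r" "2 * card D\<^sub>r \<le> 3 ^ n + 1"
    using Suc.IH[of q p] Suc.prems r unfolding g_def by blast
  define D where "D = place g p ` D\<^sub>p \<union> (place g q ` D\<^sub>q \<union> place g r ` D\<^sub>r)"
  have fin: "finite D\<^sub>p" "finite D\<^sub>q" "finite D\<^sub>r" using p q r' spreads_finite by auto
  have "place g q (outmost r g) \<in> place g q ` D\<^sub>q \<inter> place g r ` D\<^sub>r"
    using imageI[OF q(2), of "place g q"] imageI[OF r'(2), of "place g r"]
      place_shared[OF g(1) Suc.prems(2) r(1)] by simp
  then have "card (place g q ` D\<^sub>q \<union> place g r ` D\<^sub>r) + 1 \<le> card (place g q ` D\<^sub>q) + card (place g r ` D\<^sub>r)"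
    using fin by (intro card_shared_union) auto
  then have "2 * card D \<le> 3 ^ Suc n + 1"
    using card_Un_le[of "place g p ` D\<^sub>p" "place g q ` D\<^sub>q \<union> place g r ` D\<^sub>r"] p(3) q(3) r'(3)
      card_image_le[OF fin(1), of "place g p"] card_image_le[OF fin(2), of "place g q"]
      card_image_le[OF fin(3), of "place g r"] unfolding D_def by simp
  moreover have "outmost p (Suc g) \<in> D"
    using p(2) place_outmost[OF g(1) Suc.prems(1)] unfolding D_def by force
  moreover have "spreads (Suc g) D {outmost q (Suc g)}"
    unfolding spreads_def
  proof (intro conjI allI impI)
    show "D \<subseteq> verts_S (Suc g)"
      using spreads_subset[OF p(1)] spreads_subset[OF q(1)] spreads_subset[OF r'(1)]
      unfolding D_def verts_S_Suc[OF g(1)] L by auto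
    fix X assume sub: "(\<Union>v\<in>D. nbhd_S (Suc g) v) \<union> {outmost q (Suc g)} \<subseteq> X"
      and X: "forcing_closed 1 (Suc g) X"
    \<comment> \<open>Observation runs through the copies in the order \<open>q\<close>,
      \<open>p\<close>, \<open>r\<close>: corner \<open>q\<close> starts copy \<open>q\<close>, and
      each finished copy hands the next its awaited corner.\<close>
    note copy = spreads_place[OF g(1) _ _ X]
    have Q: "place g q ` verts_S g \<subseteq> X"
      using copy[OF Suc.prems(2) q(1)] sub place_outmost[OF g(1) Suc.prems(2)] unfolding D_def by auto
    then have "place g p (outmost q g) \<in> X"
      using place_shared[OF g(1) Suc.prems(1,2)] outmost_in_verts_S[OF g(1) Suc.prems(1)] by auto
    then have P: "place g p ` verts_S g \<subseteq> X"
      using copy[OF Suc.prems(1) p(1)] sub unfolding D_def by auto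
    then have "place g r (outmost p g) \<in> X"
      using place_shared[OF g(1) Suc.prems(1) r(1)] outmost_in_verts_S[OF g(1) r(1)] by auto
    then have "place g r ` verts_S g \<subseteq> X"
      using copy[OF r(1) r'(1)] sub unfolding D_def by auto
    with P Q show "verts_S (Suc g) \<subseteq> X" unfolding verts_S_Suc[OF g(1)] L by blast
  qed
  ultimately show ?case unfolding g(2) by blast
qed

text \<open>Copy 1 needs no help and supplies corner 1 to copies 2 and 3, whose sets share their
  common vertex; the count is as in \<open>ex_spreads_outmost\<close>.\<close>

lemma ex_spreads: "\<exists>D. spreads (n + 2) D {} \<and> 2 * card D \<le> 3 ^ n + 1"
proof (induction n)
  case 0
  have "0 + 2 = (2 :: nat)" by simp
  then show ?case using spreads_2_midpoint
    by (intro exI[of _ "{place 1 1 [2]}"]) (simp only:, simp)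
next
  case (Suc n)
  define g where "g = n + 2"
  have g: "0 < g" "Suc n + 2 = Suc g" by (auto simp: g_def)
  obtain D1 where D1: "spreads g D1 {}" "2 * card D1 \<le> 3 ^ n + 1"
    using Suc unfolding g_def by blast
  obtain D2 where D2: "spreads g D2 {outmost 1 g}" "outmost 3 g \<in> D2" "2 * card D2 \<le> 3 ^ n + 1"
    using ex_spreads_outmost[of 3 1 n] unfolding g_def by auto
  obtain D3 where D3: "spreads g D3 {outmost 1 g}" "outmost 2 g \<in> D3" "2 * card D3 \<le> 3 ^ n + 1"
    using ex_spreads_outmost[of 2 1 n] unfolding g_def by auto
  define D where "D = place g 1 ` D1 \<union> (place g 2 ` D2 \<union> place g 3 ` D3)"
  have fin: "finite D1" "finite D2" "finite D3" using D1 D2 D3 spreads_finite by auto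
  have "place g 2 (outmost 3 g) \<in> place g 2 ` D2 \<inter> place g 3 ` D3"
    using imageI[OF D2(2), of "place g 2"] imageI[OF D3(2), of "place g 3"]
      place_shared[OF g(1), of 2 3] by simp
  then have "card (place g 2 ` D2 \<union> place g 3 ` D3) + 1 \<le> card (place g 2 ` D2) + card (place g 3 ` D3)"
    using fin by (intro card_shared_union) auto
  then have "2 * card D \<le> 3 ^ Suc n + 1"
    using card_Un_le[of "place g 1 ` D1" "place g 2 ` D2 \<union> place g 3 ` D3"] D1(2) D2(3) D3(3)
      card_image_le[OF fin(1), of "place g 1"] card_image_le[OF fin(2), of "place g 2"]
      card_image_le[OF fin(3), of "place g 3"] unfolding D_def by simp
  moreover have "spreads (Suc g) D {}"
    unfolding spreads_def
  proof (intro conjI allI impI)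
    show "D \<subseteq> verts_S (Suc g)"
      using spreads_subset[OF D1(1)] spreads_subset[OF D2(1)] spreads_subset[OF D3(1)]
      unfolding D_def verts_S_Suc[OF g(1)] labels_def by auto
    fix X assume sub: "(\<Union>v\<in>D. nbhd_S (Suc g) v) \<union> {} \<subseteq> X"
      and X: "forcing_closed 1 (Suc g) X"
    note copy = spreads_place[OF g(1) _ _ X]
    have one: "place g 1 ` verts_S g \<subseteq> X"
      using copy[OF _ D1(1)] sub unfolding D_def by auto
    have shared: "place g t ` {outmost 1 g} \<subseteq> X" if "t \<in> labels" for t
      using one place_shared[OF g(1) that, of 1] outmost_in_verts_S[OF g(1) that] by auto
    have "place g 2 ` verts_S g \<subseteq> X" "place g 3 ` verts_S g \<subseteq> X"
      using copy[OF _ D2(1) _ shared] copy[OF _ D3(1) _ shared] sub unfolding D_def by auto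
    with one show "verts_S (Suc g) \<subseteq> X" unfolding verts_S_Suc[OF g(1)] labels_def by blast
  qed
  ultimately show ?case unfolding g(2) by blast
qed

section \<open>Lower bound for one forced neighbour\<close>

text \<open>A fort in the sense of zero forcing. It avoids corners so that the neighbourhoods of its
  members survive gluing.\<close>

definition interior_fort :: "nat \<Rightarrow> nat list set \<Rightarrow> bool" where
  "interior_fort g M \<longleftrightarrow> M \<noteq> {} \<and> M \<subseteq> verts_S g - corners g \<and>
    (\<forall>v. v \<notin> M \<longrightarrow> card {m \<in> M. v \<in> nbhd_S g m} \<noteq> 1)"

definition meets_forts :: "nat \<Rightarrow> nat list set \<Rightarrow> bool" where
  "meets_forts g D \<longleftrightarrow> (\<forall>M. interior_fort g M \<longrightarrow> D \<inter> (\<Union>m\<in>M. nbhd_S g m) \<noteq> {})"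

text \<open>Otherwise the initial domination misses \<open>M\<close>. A first vertex to force into
  \<open>M\<close> would lie outside \<open>M\<close> and have all its neighbours in
  \<open>M\<close> unobserved, hence exactly one such neighbour, against the fort property.\<close>

lemma power_dominating_set_meets_forts:
  assumes "power_dominating_set (sierpinski g) 1 D"
  shows "meets_forts g D"
  unfolding meets_forts_def
proof (intro allI impI notI)
  fix M assume M: "interior_fort g M" and disj: "D \<inter> (\<Union>m\<in>M. nbhd_S g m) = {}"
  have "power_dom_step (sierpinski g) 1 D i \<inter> M = {}" for i
  proof (induction i)
    case 0
    then show ?case using disj nbhd_S_sym[of _ g] by fastforce
  next
    case (Suc i)
    let ?P = "power_dom_step (sierpinski g) 1 D i"
    have False if v: "v \<in> ?P" "card (nbhd_S g v - ?P) \<le> 1" "m \<in> nbhd_S g v" "m \<in> M" for v m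
    proof -
      have P: "?P \<subseteq> verts_S g"
        using power_dom_step_subset[OF pair_wf_digraph_sierpinski] assms
        unfolding power_dominating_set_def by blast
      then have fin: "finite (nbhd_S g v)"
        using v(1) finite_subset[OF nbhd_S_subset finite_verts_S] by blast
      let ?A = "{m \<in> M. v \<in> nbhd_S g m}"
      have A: "?A \<subseteq> nbhd_S g v - ?P" using Suc nbhd_S_sym[of _ g] by blast
      have "card ?A \<le> 1"
        using card_mono[OF finite_Diff[OF fin] A] v(2) by (rule le_trans)
      moreover have "m \<in> ?A" using v nbhd_S_sym by simp
      moreover have "finite ?A" using A fin finite_subset by blast
      ultimately have "card ?A = 1"
        using card_gt_0_iff[of ?A] by (intro le_antisym) auto
      moreover have "v \<notin> M" using v(1) Suc by blast
      ultimately show False using M unfolding interior_fort_def by simp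
    qed
    then show ?case by auto
  qed
  then have "verts_S g \<inter> M = {}"
    using assms unfolding power_dominating_set_def power_dom_limit_def by blast
  then show False using M unfolding interior_fort_def by blast
qed

text \<open>Words in the range of \<open>place g t\<close> see the image of \<open>M\<close> as
  their preimages see \<open>M\<close>; all others see none of it.\<close>

lemma interior_fort_place:
  assumes "0 < g" "t \<in> labels" "interior_fort g M"
  shows "interior_fort (Suc g) (place g t ` M)"
  unfolding interior_fort_def
proof (intro conjI allI impI)
  have M: "M \<subseteq> verts_S g" "M \<inter> corners g = {}" "M \<noteq> {}"
    using assms(3) unfolding interior_fort_def by auto
  have N: "nbhd_S (Suc g) (place g t m) = place g t ` nbhd_S g m" if "m \<in> M" for m
    using nbhd_place_interior[OF assms(1,2)] M that by blast
  show "place g t ` M \<noteq> {}" using M by simp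
  have "outmost t g \<notin> M" using M(2) assms(2) unfolding corners_def by blast
  then show "place g t ` M \<subseteq> verts_S (Suc g) - corners (Suc g)"
    using M(1) assms(2) unfolding verts_S_Suc[OF assms(1)]
    by (auto simp: place_in_corners_iff[OF assms(1,2)])
  fix x assume x: "x \<notin> place g t ` M"
  have eq: "{y \<in> place g t ` M. x \<in> nbhd_S (Suc g) y} = place g t ` {m \<in> M. x \<in> place g t ` nbhd_S g m}"
    using N by auto
  show "card {y \<in> place g t ` M. x \<in> nbhd_S (Suc g) y} \<noteq> 1"
  proof (cases "x \<in> range (place g t)")
    case True
    then obtain w where w: "x = place g t w" by blast
    have "{m \<in> M. x \<in> place g t ` nbhd_S g m} = {m \<in> M. w \<in> nbhd_S g m}"
      unfolding w using inj_place[OF assms(1,2), of UNIV] by (simp add: inj_image_mem_iff)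
    moreover have "w \<notin> M" using x w by blast
    ultimately show ?thesis
      using assms(3) card_image[OF inj_place[OF assms(1,2)]] unfolding eq interior_fort_def by simp
  next
    case False
    then have "{m \<in> M. x \<in> place g t ` nbhd_S g m} = {}" by blast
    then show ?thesis unfolding eq by (simp only: image_empty card.empty)
  qed
qed

text \<open>The closed neighbourhood of an embedded fort stays inside its copy, so the vertex of
  \<open>D\<close> found there pulls back.\<close>

lemma meets_forts_vimage_place:
  assumes "0 < g" "t \<in> labels" "meets_forts (Suc g) D"
  shows "meets_forts g {v \<in> verts_S g. place g t v \<in> D}"
  unfolding meets_forts_def
proof (intro allI impI)
  fix M assume M: "interior_fort g M"
  then obtain m where m: "m \<in> M" "D \<inter> nbhd_S (Suc g) (place g t m) \<noteq> {}"
    using assms(3) interior_fort_place[OF assms(1,2) M] unfolding meets_forts_def by blast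
  have "m \<in> verts_S g" "m \<notin> corners g" using M m(1) unfolding interior_fort_def by auto
  then have "nbhd_S (Suc g) (place g t m) = place g t ` nbhd_S g m" "nbhd_S g m \<subseteq> verts_S g"
    using nbhd_place_interior[OF assms(1,2)] nbhd_S_subset by simp_all
  with m(2) obtain v where "v \<in> nbhd_S g m" "place g t v \<in> D" "v \<in> verts_S g" by auto
  with m(1) show "{v \<in> verts_S g. place g t v \<in> D} \<inter> (\<Union>m\<in>M. nbhd_S g m) \<noteq> {}" by auto
qed

text \<open>Each corner is adjacent to the midpoints of the two sides through it, and no other word
  outside the set is adjacent to any midpoint.\<close>

lemma interior_fort_2: "interior_fort 2 {place 1 1 [2], place 1 1 [3], place 1 2 [3]}"
  (is "interior_fort 2 ?M")
  unfolding interior_fort_def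
proof (intro conjI allI impI)
  show "?M \<noteq> {}" by simp
  show "?M \<subseteq> verts_S 2 - corners 2"
    using place_1_in_corners_iff[of 1] place_1_in_corners_iff[of 2 3] place_1_in_verts_S_2
    by (auto simp del: One_nat_def)
  fix x assume x: "x \<notin> ?M"
  have eq: "place 1 p [q] = place 1 r [s] \<longleftrightarrow> p = r \<and> q = s \<or> p = s \<and> q = r"
    if "p \<in> labels" "q \<in> labels" "r \<in> labels" "s \<in> labels" for p q r s
    using that place_eq_iff[of 1 p r "[q]" "[s]"] by auto
  show "card {m \<in> ?M. x \<in> nbhd_S 2 m} \<noteq> 1"
  proof (cases "x \<in> verts_S 2")
    case True
    then obtain t s where ts: "t \<in> labels" "s \<in> labels" "x = place 1 t [s]"
      unfolding verts_S_2 verts_S_1 by blast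
    with x have "s = t"
      using place_1_sym[of t s] by (auto simp: labels_def simp del: One_nat_def)
    \<comment> \<open>The witnesses are the midpoints of the two sides through corner
      \<open>t\<close>.\<close>
    moreover have "\<exists>a b. a \<in> ?M \<and> b \<in> ?M \<and> a \<noteq> b \<and> place 1 t [t] \<in> nbhd_S 2 a \<and> place 1 t [t] \<in> nbhd_S 2 b"
      if t: "t \<in> labels"
    proof -
      consider "t = 1" | "t = 2" | "t = 3" using t by (auto simp: labels_def)
      then show ?thesis
      proof cases
        case 1
        show ?thesis unfolding 1
          by (rule exI[of _ "place 1 1 [2]"], rule exI[of _ "place 1 1 [3]"])
            (auto simp: eq nbhd_S_2 verts_S_1 simp del: One_nat_def)
      next
        case 2
        show ?thesis unfolding 2
          by (rule exI[of _ "place 1 1 [2]"], rule exI[of _ "place 1 2 [3]"])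
            (auto simp: eq nbhd_S_2 verts_S_1 simp del: One_nat_def)
      next
        case 3
        show ?thesis unfolding 3
          by (rule exI[of _ "place 1 1 [3]"], rule exI[of _ "place 1 2 [3]"])
            (auto simp: eq nbhd_S_2 verts_S_1 simp del: One_nat_def)
      qed
    qed
    ultimately obtain a b where "{a, b} \<subseteq> {m \<in> ?M. x \<in> nbhd_S 2 m}" "a \<noteq> b"
      using ts by blast
    then have "\<nexists>c. {m \<in> ?M. x \<in> nbhd_S 2 m} = {c}" by (metis insert_subset singletonD)
    then show ?thesis by (simp only: card_1_singleton_iff One_nat_def not_False_eq_True)
  next
    case False
    have "nbhd_S 2 m \<subseteq> verts_S 2" if "m \<in> ?M" for m
      using that \<open>?M \<subseteq> verts_S 2 - corners 2\<close> nbhd_S_subset by blast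
    then have "{m \<in> ?M. x \<in> nbhd_S 2 m} = {}" using False by blast
    then show ?thesis by (simp only: card.empty)
  qed
qed

text \<open>A corner of two glued copies is counted in each of them, so the weights of the copies add up to
  the weight in the glued graph.\<close>

definition weight :: "nat \<Rightarrow> nat list \<Rightarrow> nat" where
  "weight g v = (if v \<in> corners g then 1 else 2)"

text \<open>A glued vertex has two corners as preimages, and 1 + 1 is its weight 2 as a non-corner.
  Any other fibre has at most one element, which is a corner exactly when \<open>x\<close>
  is.\<close>

lemma weight_fibre:
  assumes "0 < g"
  shows "(\<Sum>z | z \<in> labels \<times> verts_S g \<and> place g (fst z) (snd z) = x. weight g (snd z))
    \<le> weight (Suc g) x"
    (is "sum ?w ?F \<le> _")
proof (cases "?F = {}")
  case False
  then obtain t v where tv: "t \<in> labels" "place g t v = x" by auto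
  have fibre: "a = t \<and> b = v \<or> a \<noteq> t \<and> b = outmost t g \<and> v = outmost a g \<and> a \<in> labels"
    if "(a, b) \<in> ?F" for a b
    using that tv place_eq_iff[OF assms _ tv(1), of a b v] by auto
  show ?thesis
  proof (cases "\<exists>s\<in>labels. s \<noteq> t \<and> v = outmost s g")
    case True
    then obtain s where s: "s \<in> labels" "s \<noteq> t" "v = outmost s g" by blast
    have "?F \<subseteq> {(t, outmost s g), (s, outmost t g)}"
    proof (rule subrelI)
      fix a b assume "(a, b) \<in> ?F"
      from fibre[OF this] show "(a, b) \<in> {(t, outmost s g), (s, outmost t g)}"
        using s(3) by (auto simp: outmost_eq_iff[OF assms])
    qed
    then have "sum ?w ?F \<le> sum ?w {(t, outmost s g), (s, outmost t g)}"
      by (intro sum_mono2) auto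
    also have "\<dots> = 2" using s tv by (auto simp: weight_def corners_def)
    also have "2 = weight (Suc g) x"
      using place_in_corners_iff[OF assms tv(1), of v] tv s outmost_eq_iff[OF assms]
      by (simp add: weight_def)
    finally show ?thesis .
  next
    case False
    have "?F \<subseteq> {(t, v)}"
    proof (rule subrelI)
      fix a b assume "(a, b) \<in> ?F"
      from fibre[OF this] False show "(a, b) \<in> {(t, v)}" by auto
    qed
    then have "sum ?w ?F \<le> sum ?w {(t, v)}"
      by (intro sum_mono2) auto
    also have "\<dots> \<le> weight (Suc g) x"
      using place_in_corners_iff[OF assms tv(1), of v] tv by (auto simp: weight_def corners_def)
    finally show ?thesis .
  qed
qed (simp only: sum.empty zero_le)

text \<open>Each of the three copies contributes \<open>3 ^ n\<close>, and weights can be added over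
  copies without overcounting glued vertices. At the start, the fort makes \<open>D\<close> nonempty
  and every weight is at least 1.\<close>

lemma weight_lower_bound:
  assumes "D \<subseteq> verts_S (n + 2)" "meets_forts (n + 2) D"
  shows "3 ^ n \<le> (\<Sum>v\<in>D. weight (n + 2) v)"
  using assms
proof (induction n arbitrary: D)
  case 0
  have "0 + 2 = (2 :: nat)" by simp
  then have "D \<noteq> {}"
    using 0(2) interior_fort_2 unfolding meets_forts_def by (metis Int_empty_left)
  then obtain v where v: "v \<in> D" by blast
  have "finite D" using 0 finite_verts_S finite_subset by blast
  then have "weight 2 v \<le> (\<Sum>v\<in>D. weight 2 v)" using v by (intro member_le_sum) auto
  moreover have "1 \<le> weight 2 v" by (simp add: weight_def)
  ultimately have "1 \<le> (\<Sum>v\<in>D. weight 2 v)" by (rule le_trans[rotated])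
  then show ?case by (simp only: add_0 power_0)
next
  case (Suc n)
  define g where "g = n + 2"
  have g: "0 < g" "Suc n + 2 = Suc g" by (auto simp: g_def)
  define E where "E t = {v \<in> verts_S g. place g t v \<in> D}" for t
  have finE: "finite (E t)" for t unfolding E_def using finite_verts_S by simp
  have finD: "finite D" using Suc.prems finite_verts_S finite_subset by blast
  have IH: "3 ^ n \<le> (\<Sum>v\<in>E t. weight g v)" if "t \<in> labels" for t
    using Suc.IH[of "E t"] meets_forts_vimage_place[OF g(1) that] Suc.prems(2)
    unfolding g(2) E_def g_def[symmetric] by blast
  have "3 ^ Suc n = (\<Sum>t\<in>labels. 3 ^ n :: nat)" by simp
  also have "\<dots> \<le> (\<Sum>t\<in>labels. \<Sum>v\<in>E t. weight g v)" by (intro sum_mono IH)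
  also have "\<dots> = (\<Sum>z\<in>Sigma labels E. weight g (snd z))"
    using finE by (subst sum.Sigma) (auto simp: case_prod_beta)
  \<comment> \<open>Double counting: pairs of a copy and a vertex in it are grouped by their image
    in \<open>D\<close>.\<close>
  also have "\<dots> = (\<Sum>x\<in>D. \<Sum>z | z \<in> Sigma labels E \<and> place g (fst z) (snd z) = x. weight g (snd z))"
    using finD finE by (intro sum.group[symmetric]) (auto simp: E_def)
  also have "\<dots> \<le> (\<Sum>x\<in>D. weight (Suc g) x)"
  proof (rule sum_mono)
    fix x
    have "(\<Sum>z | z \<in> Sigma labels E \<and> place g (fst z) (snd z) = x. weight g (snd z)) \<le>
      (\<Sum>z | z \<in> labels \<times> verts_S g \<and> place g (fst z) (snd z) = x. weight g (snd z))"
      using finite_verts_S by (intro sum_mono2) (auto simp: E_def)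
    also have "\<dots> \<le> weight (Suc g) x" by (rule weight_fibre[OF g(1)])
    finally show "(\<Sum>z | z \<in> Sigma labels E \<and> place g (fst z) (snd z) = x. weight g (snd z))
      \<le> weight (Suc g) x" .
  qed
  finally show ?case unfolding g(2) .
qed

section \<open>The exact value for one forced neighbour\<close>

lemma power_dom_number_1:
  "2 * power_dom_number (sierpinski (n + 2)) 1 = 3 ^ n + 1"
proof -
  have odd: "odd (3 ^ n :: nat)" by simp
  then obtain m where m: "(3::nat) ^ n + 1 = 2 * m" by (metis even_add odd_one evenE)
  obtain D where D: "spreads (n + 2) D {}" "2 * card D \<le> 3 ^ n + 1" using ex_spreads by blast
  have "power_dom_number (sierpinski (n + 2)) 1 = m"
  proof (rule power_dom_number_eqI)
    show "power_dominating_set (sierpinski (n + 2)) 1 D"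
      using D(1) by (intro power_dominating_setI) (auto simp: spreads_def)
    show "card D \<le> m" using D(2) m by simp
    fix E assume E: "power_dominating_set (sierpinski (n + 2)) 1 E"
    then have "3 ^ n \<le> (\<Sum>v\<in>E. weight (n + 2) v)"
      using weight_lower_bound power_dominating_set_meets_forts unfolding power_dominating_set_def by blast
    also have "\<dots> \<le> (\<Sum>v\<in>E. 2)" by (intro sum_mono) (simp add: weight_def)
    \<comment> \<open>The weights give only \<open>3 ^ n \<le> 2 * card E\<close>; as
      \<open>3 ^ n = 2 * m - 1\<close> is odd, this rounds up to \<open>m\<close>.\<close>
    finally show "m \<le> card E" using m by simp
  qed
  then show ?thesis using m by simp
qed

theorem theorem3:
  fixes k g :: nat
  assumes "k > 0" and "g > 0"
  shows "(g \<ge> 2 \<and> k = 1 \<longrightarrow>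
            real (power_dom_number (sierpinski g) k) = (3 ^ (g - 2) + 1) / 2) \<and>
         (g = 1 \<and> k = 1 \<longrightarrow> power_dom_number (sierpinski g) k = 1) \<and>
         (k \<ge> 2 \<longrightarrow> power_dom_number (sierpinski g) k = 1)"
proof (intro conjI impI)
  assume *: "g \<ge> 2 \<and> k = 1"
  then have "2 * power_dom_number (sierpinski g) k = 3 ^ (g - 2) + 1"
    using power_dom_number_1[of "g - 2"] by (simp only: le_add_diff_inverse2)
  then have "real (2 * power_dom_number (sierpinski g) k) = real (3 ^ (g - 2) + 1)" by (rule arg_cong)
  then show "real (power_dom_number (sierpinski g) k) = (3 ^ (g - 2) + 1) / 2" by simp
next
  assume "g = 1 \<and> k = 1"
  then show "power_dom_number (sierpinski g) k = 1" using power_dom_number_eq_1[of g k] by simp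
next
  assume "2 \<le> k"
  then show "power_dom_number (sierpinski g) k = 1" using power_dom_number_eq_1[of g k] assms by simp
qed

end
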